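(* Let $\varphi:\mathbb{R}^n\to\mathbb{R}$ be of class $C^{1,1}$ and bounded from below, and let $x^0\in\mathbb{R}^n$ be such that for every $x\in\mathbb{R}^n$ with $\varphi(x)\le\varphi(x^0)$ the generalized Hessian $\partial^2\varphi(x)$ is positive-semidefinite. Consider Algorithm GRNM-W (described in the context) started at $x^0$. If $\nabla\varphi(x^k)\neq 0$ at an iterate $x^k$, then there exists $d^k\neq 0$ such that $$-\nabla\varphi(x^k)\in\partial^2\varphi(x^k)(d^k)+\mu_kB_kd^k,$$ and the Wolfe linesearch is well-defined (i.e., there exists a stepsize $\tau_k>0$ satisfying both Wolfe conditions for $x^k$ and $d^k$). Moreover, the algorithm either stops after finitely many iterations at a stationary point of $\varphi$ (a point where $\nabla\varphi=0$), or generates an infinite sequence $\{x^k\}$ such that $\{\varphi(x^k)\}$ is decreasing.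
   Context: A function is of class $C^{1,1}$ if it is continuously differentiable with locally Lipschitz gradient. For a set $\Omega\subset\mathbb{R}^s$ and $\bar z\in\Omega$, the regular normal cone is $\widehat N_\Omega(\bar z)=\{v\mid \limsup_{z\to\bar z,\,z\in\Omega}\langle v,z-\bar z\rangle/\|z-\bar z\|\le 0\}$, and the limiting normal cone $N_\Omega(\bar z)$ is the set of all $v$ for which there are $z_k\to\bar z$ with $z_k\in\Omega$, and $v_k\to v$ with $v_k\in\widehat N_\Omega(z_k)$. For $\varphi$ of class $C^{1,1}$, the generalized Hessian at $x$ is the set-valued mapping $\partial^2\varphi(x):\mathbb{R}^n\rightrightarrows\mathbb{R}^n$, $\partial^2\varphi(x)(u)=\{z\mid (z,-u)\in N_{\mathrm{gph}\,\nabla\varphi}(x,\nabla\varphi(x))\}$ (the limiting coderivative of $\nabla\varphi$). It is positive-semidefinite if $\langle z,u\rangle\ge 0$ for all $u\in\mathbb{R}^n$ and all $z\in\partial^2\varphi(x)(u)$. Algorithm GRNM-W. Input: $x^0\in\mathbb{R}^n$, $c>0$, $0<\sigma_1<\sigma_2<1$, $\rho\in(0,1]$. For $k=0,1,\ldots$: (1) If $\nabla\varphi(x^k)=0$, stop; otherwise set $\mu_k=c\|\nabla\varphi(x^k)\|^\rho$. (2) Choose a symmetric positive-definite matrix $B_k$ and find $d^k\in\mathbb{R}^n$ with $-\nabla\varphi(x^k)\in\partial^2\varphi(x^k)(d^k)+\mu_kB_kd^k$. (3) If $\tau_k=1$ satisfies the Wolfe conditions $$\varphi(x^k+\tau_kd^k)\le\varphi(x^k)+\sigma_1\tau_k\langle\nabla\varphi(x^k),d^k\rangle,\qquad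 \langle\nabla\varphi(x^k+\tau_kd^k),d^k\rangle\ge\sigma_2\langle\nabla\varphi(x^k),d^k\rangle,$$ take $\tau_k=1$; otherwise take any $\tau_k>0$ satisfying them. It is assumed that the stepsizes used by the implementation are bounded above by some constant $\tau_{\max}$. (4) Set $x^{k+1}=x^k+\tau_kd^k$. *)

theory Defs
  imports "HOL-Analysis.Analysis"
begin

definition grad :: "('a::euclidean_space \<Rightarrow> real) \<Rightarrow> 'a \<Rightarrow> 'a" where
  "grad \<phi> x = (THE D. GDERIV \<phi> x :> D)"

definition C11 :: "('a::euclidean_space \<Rightarrow> real) \<Rightarrow> bool" where
  "C11 \<phi> \<longleftrightarrow>
     (\<forall>x. \<phi> differentiable (at x)) \<and>
     continuous_on UNIV (grad \<phi>) \<and>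
     (\<forall>x. \<exists>r>0. \<exists>L. L-lipschitz_on (ball x r) (grad \<phi>))"

text \<open>The filter \<^term>\<open>at z within \<Omega>\<close> omits the point \<^term>\<open>z\<close> itself. At an isolated point of
  \<^term>\<open>\<Omega>\<close> it is the trivial filter, for which the limit superior is \<open>- \<infinity>\<close>, so that the cone is the
  whole space.\<close>

definition regular_normal_cone :: "'a::euclidean_space set \<Rightarrow> 'a \<Rightarrow> 'a set" where
  "regular_normal_cone \<Omega> z =
     {v. Limsup (at z within \<Omega>) (\<lambda>y. ereal (v \<bullet> (y - z) / norm (y - z))) \<le> 0}"

definition limiting_normal_cone :: "'a::euclidean_space set \<Rightarrow> 'a \<Rightarrow> 'a set" where
  "limiting_normal_cone \<Omega> z =
     {v. \<exists>y w. y \<longlonglongrightarrow> z \<and> w \<longlonglongrightarrow> v \<and>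
               (\<forall>k::nat. y k \<in> \<Omega> \<and> w k \<in> regular_normal_cone \<Omega> (y k))}"

definition gph :: "('a \<Rightarrow> 'b) \<Rightarrow> ('a \<times> 'b) set" where
  "gph f = {(x, f x) | x. True}"

definition gen_hessian :: "('a::euclidean_space \<Rightarrow> real) \<Rightarrow> 'a \<Rightarrow> 'a \<Rightarrow> 'a set" where
  "gen_hessian \<phi> x u = {z. (z, - u) \<in> limiting_normal_cone (gph (grad \<phi>)) (x, grad \<phi> x)}"

definition psd_gen_hessian :: "('a::euclidean_space \<Rightarrow> real) \<Rightarrow> 'a \<Rightarrow> bool" where
  "psd_gen_hessian \<phi> x \<longleftrightarrow> (\<forall>u. \<forall>z \<in> gen_hessian \<phi> x u. z \<bullet> u \<ge> 0)"

definition sym_posdef :: "real^'n^'n \<Rightarrow> bool" where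
  "sym_posdef B \<longleftrightarrow> transpose B = B \<and> (\<forall>v. v \<noteq> 0 \<longrightarrow> v \<bullet> (B *v v) > 0)"

definition reg_param :: "(real^'n \<Rightarrow> real) \<Rightarrow> real \<Rightarrow> real \<Rightarrow> real^'n \<Rightarrow> real" where
  "reg_param \<phi> c \<rho> x = c * norm (grad \<phi> x) powr \<rho>"

definition newton_direction ::
  "(real^'n \<Rightarrow> real) \<Rightarrow> real \<Rightarrow> real \<Rightarrow> real^'n \<Rightarrow> real^'n^'n \<Rightarrow> real^'n \<Rightarrow> bool" where
  "newton_direction \<phi> c \<rho> x B d \<longleftrightarrow>
     - grad \<phi> x \<in> {z + reg_param \<phi> c \<rho> x *\<^sub>R (B *v d) | z. z \<in> gen_hessian \<phi> x d}"

definition wolfe ::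
  "(real^'n \<Rightarrow> real) \<Rightarrow> real \<Rightarrow> real \<Rightarrow> real^'n \<Rightarrow> real^'n \<Rightarrow> real \<Rightarrow> bool" where
  "wolfe \<phi> \<sigma>1 \<sigma>2 x d \<tau> \<longleftrightarrow>
     \<phi> (x + \<tau> *\<^sub>R d) \<le> \<phi> x + \<sigma>1 * \<tau> * (grad \<phi> x \<bullet> d) \<and>
     grad \<phi> (x + \<tau> *\<^sub>R d) \<bullet> d \<ge> \<sigma>2 * (grad \<phi> x \<bullet> d)"

definition grnmw_step ::
  "(real^'n \<Rightarrow> real) \<Rightarrow> real \<Rightarrow> real \<Rightarrow> real \<Rightarrow> real \<Rightarrow> real \<Rightarrow>
   real^'n \<Rightarrow> real^'n^'n \<Rightarrow> real^'n \<Rightarrow> real \<Rightarrow> real^'n \<Rightarrow> bool" where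
  "grnmw_step \<phi> c \<rho> \<sigma>1 \<sigma>2 \<tau>max x B d \<tau> x' \<longleftrightarrow>
     grad \<phi> x \<noteq> 0 \<and>
     sym_posdef B \<and>
     newton_direction \<phi> c \<rho> x B d \<and>
     (if wolfe \<phi> \<sigma>1 \<sigma>2 x d 1 then \<tau> = 1 else \<tau> > 0 \<and> wolfe \<phi> \<sigma>1 \<sigma>2 x d \<tau>) \<and>
     \<tau> \<le> \<tau>max \<and>
     x' = x + \<tau> *\<^sub>R d"

text \<open>The first \<open>N \<le> \<infinity>\<close> iterations of the algorithm, with iterates \<open>x k\<close> for \<open>k \<le> N\<close>; sequence
  entries beyond that are irrelevant.\<close>

definition grnmw_run ::
  "(real^'n \<Rightarrow> real) \<Rightarrow> real \<Rightarrow> real \<Rightarrow> real \<Rightarrow> real \<Rightarrow> real \<Rightarrow> real^'n \<Rightarrow> enat \<Rightarrow>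
   (nat \<Rightarrow> real^'n) \<Rightarrow> (nat \<Rightarrow> real^'n^'n) \<Rightarrow> (nat \<Rightarrow> real^'n) \<Rightarrow> (nat \<Rightarrow> real) \<Rightarrow> bool" where
  "grnmw_run \<phi> c \<rho> \<sigma>1 \<sigma>2 \<tau>max x0 N x B d \<tau> \<longleftrightarrow>
     x 0 = x0 \<and>
     (\<forall>k. enat k < N \<longrightarrow> grnmw_step \<phi> c \<rho> \<sigma>1 \<sigma>2 \<tau>max (x k) (B k) (d k) (\<tau> k) (x (Suc k)))"

text \<open>The algorithm may break down at \<open>x\<close>: for some admissible choice of the matrix there is no
  direction to be found, or for some admissible choice of matrix and direction there is no stepsize
  satisfying the Wolfe conditions.\<close>

definition grnmw_breakdown ::
  "(real^'n \<Rightarrow> real) \<Rightarrow> real \<Rightarrow> real \<Rightarrow> real \<Rightarrow> real \<Rightarrow> real^'n \<Rightarrow> bool" where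
  "grnmw_breakdown \<phi> c \<rho> \<sigma>1 \<sigma>2 x \<longleftrightarrow>
     grad \<phi> x \<noteq> 0 \<and>
     (\<exists>B. sym_posdef B \<and>
        ((\<nexists>d. newton_direction \<phi> c \<rho> x B d) \<or>
         (\<exists>d. newton_direction \<phi> c \<rho> x B d \<and> (\<nexists>\<tau>. \<tau> > 0 \<and> wolfe \<phi> \<sigma>1 \<sigma>2 x d \<tau>))))"

text \<open>A complete execution is either infinite, or it is finite and ends where the stopping test holds
  or where the algorithm breaks down.\<close>

definition grnmw_execution ::
  "(real^'n \<Rightarrow> real) \<Rightarrow> real \<Rightarrow> real \<Rightarrow> real \<Rightarrow> real \<Rightarrow> real \<Rightarrow> real^'n \<Rightarrow> enat \<Rightarrow>
   (nat \<Rightarrow> real^'n) \<Rightarrow> (nat \<Rightarrow> real^'n^'n) \<Rightarrow> (nat \<Rightarrow> real^'n) \<Rightarrow> (nat \<Rightarrow> real) \<Rightarrow> bool" where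
  "grnmw_execution \<phi> c \<rho> \<sigma>1 \<sigma>2 \<tau>max x0 N x B d \<tau> \<longleftrightarrow>
     grnmw_run \<phi> c \<rho> \<sigma>1 \<sigma>2 \<tau>max x0 N x B d \<tau> \<and>
     (\<forall>K. N = enat K \<longrightarrow> grad \<phi> (x K) = 0 \<or> grnmw_breakdown \<phi> c \<rho> \<sigma>1 \<sigma>2 (x K))"

end

theory Submission
  imports Defs
begin

text \<open>Fix an iterate x with gradient g \<noteq> 0 and put F = \<nabla>\<phi> + A, where A =
  \<mu> B is self-adjoint and positive definite. A Newton direction is a d with -g in the limiting
  coderivative of F at x applied to d, and finding one is the heart of the matter. Semidefiniteness
  is available only at x, since a neighbourhood of x may leave the sublevel set; yet compactness and
  the local Lipschitz bound spread it to coercivity, z \<bullet> d \<ge> \<delta> |d|^2, of the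
  regular coderivatives of F near x (\<open>psd_gen_hessian_coercive\<close>). A nonsmooth mean
  value inequality (\<open>approximate_mean_value\<close>) then makes F injective near x
  (\<open>scalar_subgradient_coercive_inj_on\<close>), and penalising the constraint F y = F x in
  the minimisation of g \<bullet> y produces multipliers whose limit is d
  (\<open>regularized_newton_solvable\<close>).

  Every such d is a descent direction: pairing the inclusion with d gives -(g \<bullet> d) = z
  \<bullet> d + \<mu> (d \<bullet> B d) with z in the generalized Hessian, where the first term is
  nonnegative and the second positive. Here d = 0 is impossible, as it would force z = 0 and g = 0
  (\<open>newton_direction_descent\<close>). Since \<phi> is bounded below, a Wolfe step exists
  along d (\<open>wolfe_step_exists\<close>). The first Wolfe condition makes \<phi> strictly
  decrease, so by induction the iterates stay in the sublevel set of x0, where semidefiniteness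
  holds (\<open>grnmw_run_sublevel\<close>). Hence the algorithm never breaks down, and a finite
  execution can end only at a stationary point.\<close>

section \<open>Gradients and regular normals\<close>

lemma GDERIV_unique:
  assumes "GDERIV f x :> D" and "GDERIV f x :> E"
  shows "D = E"
proof -
  have "(\<lambda>h. h \<bullet> D) = (\<lambda>h. h \<bullet> E)"
    using assms unfolding gderiv_def by (rule has_derivative_unique)
  then have "(D - E) \<bullet> D = (D - E) \<bullet> E" by meson
  then have "(D - E) \<bullet> (D - E) = 0" by (simp add: inner_diff_right)
  then show ?thesis by simp
qed

lemma GDERIV_grad:
  fixes f :: "'a::euclidean_space \<Rightarrow> real"
  assumes "f differentiable (at x)"
  shows "GDERIV f x :> grad f x"
proof -
  obtain f' where f': "(f has_derivative f') (at x)"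
    using assms unfolding differentiable_def by blast
  then have lin: "linear f'" by (rule has_derivative_linear)
  \<comment> \<open>The Riesz representative of the functional f' is its adjoint applied to
    1.\<close>
  have "f' h = h \<bullet> adjoint f' 1" for h
    using adjoint_works[OF lin, of h 1] by simp
  then have D: "GDERIV f x :> adjoint f' 1"
    unfolding gderiv_def by (intro has_derivative_eq_rhs[OF f'] ext)
  have "grad f x = adjoint f' 1"
    unfolding grad_def
  proof (rule the_equality)
    show "GDERIV f x :> adjoint f' 1" by (rule D)
    show "E = adjoint f' 1" if "GDERIV f x :> E" for E
      by (rule GDERIV_unique[OF that D])
  qed
  with D show ?thesis by simp
qed

lemma C11_GDERIV: "C11 \<phi> \<Longrightarrow> GDERIV \<phi> x :> grad \<phi> x"
  by (simp add: C11_def GDERIV_grad)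

text \<open>Multiplying out the quotient replaces the extended-real limit superior by an epsilon
  condition; at an isolated point both sides hold vacuously.\<close>

lemma mem_regular_normal_cone_iff:
  "v \<in> regular_normal_cone \<Omega> z \<longleftrightarrow>
     (\<forall>e>0. \<forall>\<^sub>F y in at z within \<Omega>. v \<bullet> (y - z) \<le> e * norm (y - z))"
proof -
  let ?X = "\<lambda>y. v \<bullet> (y - z) / norm (y - z)"
  have "v \<in> regular_normal_cone \<Omega> z \<longleftrightarrow> (\<forall>c>0. \<forall>\<^sub>F y in at z within \<Omega>. ereal (?X y) < c)"
    by (simp add: regular_normal_cone_def Limsup_le_iff)
  also have "\<dots> \<longleftrightarrow> (\<forall>e>0. \<forall>\<^sub>F y in at z within \<Omega>. v \<bullet> (y - z) \<le> e * norm (y - z))"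
  proof (intro iffI allI impI)
    fix e :: real
    assume *: "\<forall>c>0. \<forall>\<^sub>F y in at z within \<Omega>. ereal (?X y) < c" and "e > 0"
    then have "\<forall>\<^sub>F y in at z within \<Omega>. ereal (?X y) < ereal e"
      by (metis ereal_less(2))
    moreover have "\<forall>\<^sub>F y in at z within \<Omega>. y \<noteq> z"
      by (simp add: eventually_at_filter)
    ultimately show "\<forall>\<^sub>F y in at z within \<Omega>. v \<bullet> (y - z) \<le> e * norm (y - z)"
      by eventually_elim (simp add: pos_divide_less_eq)
  next
    fix c :: ereal
    assume *: "\<forall>e>0. \<forall>\<^sub>F y in at z within \<Omega>. v \<bullet> (y - z) \<le> e * norm (y - z)" and "c > 0"
    then obtain e where e: "e > 0" "ereal e < c"
      using ereal_dense2[of 0 c] by (metis zero_ereal_def less_ereal.simps(1))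
    have "\<forall>\<^sub>F y in at z within \<Omega>. v \<bullet> (y - z) \<le> e * norm (y - z)" using * e by blast
    moreover have "\<forall>\<^sub>F y in at z within \<Omega>. y \<noteq> z"
      by (simp add: eventually_at_filter)
    ultimately show "\<forall>\<^sub>F y in at z within \<Omega>. ereal (?X y) < c"
    proof eventually_elim
      case (elim y)
      then have "?X y \<le> e" by (simp add: pos_divide_le_eq)
      then show ?case using e(2) by (meson ereal_less_eq(3) le_less_trans)
    qed
  qed
  finally show ?thesis .
qed

section \<open>Regular coderivatives as subgradients of scalarisations\<close>

text \<open>This is the Frechet subdifferential at v of the real function y \<mapsto> d \<bullet> G
  y. Its elements are regular coderivatives of G, which turns questions about normals to a graph
  into minimisation of real functions.\<close>

definition scalar_subgradient :: "('a::euclidean_space \<Rightarrow> 'b::euclidean_space) \<Rightarrow> 'a \<Rightarrow> 'b \<Rightarrow> 'a \<Rightarrow> bool"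
  where "scalar_subgradient G v d z \<longleftrightarrow>
     (\<forall>e>0. \<forall>\<^sub>F y in at v. z \<bullet> (y - v) - e * norm (y - v) \<le> d \<bullet> (G y - G v))"

text \<open>Proximal subgradients are Frechet subgradients. Minimisers of quadratic penalty
  functions yield estimates of this quadratic kind.\<close>

lemma scalar_subgradient_quadraticI:
  assumes ev: "\<forall>\<^sub>F y in nhds v. z \<bullet> (y - v) - C * (norm (y - v))\<^sup>2 \<le> d \<bullet> (G y - G v)"
  shows "scalar_subgradient G v d z"
  unfolding scalar_subgradient_def
proof (intro allI impI)
  fix e :: real assume "e > 0"
  have "((\<lambda>y. C * norm (y - v)) \<longlongrightarrow> C * norm (v - v)) (at v)"
    by (intro tendsto_intros)
  then have "\<forall>\<^sub>F y in at v. C * norm (y - v) < e"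
    using \<open>e > 0\<close> by (auto dest!: order_tendstoD(2)[of _ _ _ e])
  moreover have "\<forall>\<^sub>F y in at v. z \<bullet> (y - v) - C * (norm (y - v))\<^sup>2 \<le> d \<bullet> (G y - G v)"
    using ev by (simp add: eventually_at_filter eventually_mono)
  ultimately show "\<forall>\<^sub>F y in at v. z \<bullet> (y - v) - e * norm (y - v) \<le> d \<bullet> (G y - G v)"
  proof eventually_elim
    case (elim y)
    then have "C * (norm (y - v))\<^sup>2 \<le> e * norm (y - v)"
      unfolding power2_eq_square mult.assoc[symmetric] by (intro mult_right_mono) auto
    with elim show ?case by linarith
  qed
qed

lemma scalar_subgradient_scale:
  assumes "scalar_subgradient G v d z" and "t > 0"
  shows "scalar_subgradient G v (t *\<^sub>R d) (t *\<^sub>R z)"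
  unfolding scalar_subgradient_def
proof (intro allI impI)
  fix e :: real assume "e > 0"
  then have "\<forall>\<^sub>F y in at v. z \<bullet> (y - v) - (e / t) * norm (y - v) \<le> d \<bullet> (G y - G v)"
    using assms unfolding scalar_subgradient_def by (meson divide_pos_pos)
  then show "\<forall>\<^sub>F y in at v. (t *\<^sub>R z) \<bullet> (y - v) - e * norm (y - v) \<le> (t *\<^sub>R d) \<bullet> (G y - G v)"
  proof eventually_elim
    case (elim y)
    then have "t * (z \<bullet> (y - v) - (e / t) * norm (y - v)) \<le> t * (d \<bullet> (G y - G v))"
      using \<open>t > 0\<close> by (intro mult_left_mono) auto
    then show ?case using \<open>t > 0\<close> by (simp add: right_diff_distrib)
  qed
qed

text \<open>Exact sum rule: y \<mapsto> d \<bullet> A y is linear with gradient A d.\<close>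

lemma scalar_subgradient_add_selfadjoint:
  assumes "scalar_subgradient (\<lambda>y. G y + A y) v d z"
    and "linear A" and "\<And>u w. A u \<bullet> w = u \<bullet> A w"
  shows "scalar_subgradient G v d (z - A d)"
proof -
  have "(z - A d) \<bullet> (y - v) - b \<le> d \<bullet> (G y - G v) \<longleftrightarrow>
      z \<bullet> (y - v) - b \<le> d \<bullet> (G y + A y - (G v + A v))" for y b
    using assms(3)[of d "y - v"] linear_diff[OF assms(2), of y v]
    by (auto simp: inner_diff_left inner_diff_right inner_add_right)
  then show ?thesis using assms(1) unfolding scalar_subgradient_def by simp
qed

text \<open>Norms of graph increments dominate those of their first components, so an error small in
  the domain is small along the graph.\<close>

lemma scalar_subgradient_imp_regular_normal:
  assumes "scalar_subgradient G v d z"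
  shows "(z, - d) \<in> regular_normal_cone (gph G) (v, G v)"
  unfolding mem_regular_normal_cone_iff
proof (intro allI impI)
  fix e :: real assume "e > 0"
  then have "\<forall>\<^sub>F y in at v. z \<bullet> (y - v) - e * norm (y - v) \<le> d \<bullet> (G y - G v)"
    using assms unfolding scalar_subgradient_def by blast
  then obtain r where r: "r > 0"
    "\<And>y. y \<noteq> v \<Longrightarrow> dist y v < r \<Longrightarrow> z \<bullet> (y - v) - e * norm (y - v) \<le> d \<bullet> (G y - G v)"
    unfolding eventually_at by auto
  show "\<forall>\<^sub>F p in at (v, G v) within gph G.
          (z, - d) \<bullet> (p - (v, G v)) \<le> e * norm (p - (v, G v))"
    unfolding eventually_at
  proof (intro exI[of _ r] conjI ballI impI r(1))
    fix p assume "p \<in> gph G" and p: "p \<noteq> (v, G v) \<and> dist p (v, G v) < r"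
    then obtain y where y: "p = (y, G y)" by (auto simp: gph_def)
    have "y \<noteq> v" using p y by auto
    moreover have "dist y v < r"
      using p y dist_fst_le[of p "(v, G v)"] by simp
    ultimately have "z \<bullet> (y - v) - d \<bullet> (G y - G v) \<le> e * norm (y - v)"
      using r(2)[of y] by linarith
    also have "\<dots> \<le> e * norm (p - (v, G v))"
      using norm_fst_le[of "y - v" "G y - G v"] y \<open>e > 0\<close> by simp
    finally show "(z, - d) \<bullet> (p - (v, G v)) \<le> e * norm (p - (v, G v))"
      by (simp add: y)
  qed
qed

text \<open>Test the normal along the graph over y = v + t z for small t > 0: the first component
  contributes t |z|^2, while G moves by at most L t |z|. Dividing by t |z| gives the bound up to an
  arbitrarily small error.\<close>

lemma regular_normal_gph_bound:
  fixes G :: "'a::euclidean_space \<Rightarrow> 'b::euclidean_space"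
  assumes lip: "L-lipschitz_on (ball x r) G" and v: "v \<in> ball x r"
    and nrm: "(z, - d) \<in> regular_normal_cone (gph G) (v, G v)"
  shows "norm z \<le> L * norm d"
proof (cases "z = 0")
  case True
  then show ?thesis using lipschitz_on_nonneg[OF lip] by simp
next
  case False
  have L: "L \<ge> 0" using lipschitz_on_nonneg[OF lip] .
  have "norm z \<le> L * norm d + e * (1 + L)" if "e > 0" for e
  proof -
    obtain s where s: "s > 0" "\<And>p. p \<in> gph G \<Longrightarrow> p \<noteq> (v, G v) \<Longrightarrow> dist p (v, G v) < s \<Longrightarrow>
        (z, - d) \<bullet> (p - (v, G v)) \<le> e * norm (p - (v, G v))"
      using nrm \<open>e > 0\<close> unfolding mem_regular_normal_cone_iff eventually_at by metis
    have "((\<lambda>t. v + t *\<^sub>R z) \<longlongrightarrow> v + 0 *\<^sub>R z) (at_right 0)"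
      by (intro tendsto_intros)
    then have "\<forall>\<^sub>F t in at_right 0. v + t *\<^sub>R z \<in> ball x r"
      using v by (intro topological_tendstoD) auto
    moreover have "((\<lambda>t. (1 + L) * (t * norm z)) \<longlongrightarrow> (1 + L) * (0 * norm z)) (at_right 0)"
      by (intro tendsto_intros)
    then have "\<forall>\<^sub>F t in at_right 0. (1 + L) * (t * norm z) < s"
      using s(1) by (intro order_tendstoD(2)) auto
    moreover have "\<forall>\<^sub>F t in at_right (0::real). t > 0"
      by (simp add: eventually_at_right_less)
    ultimately have "\<forall>\<^sub>F t in at_right 0. v + t *\<^sub>R z \<in> ball x r \<and> (1 + L) * (t * norm z) < s \<and> t > 0"
      by eventually_elim simp
    then obtain t where t: "v + t *\<^sub>R z \<in> ball x r" "(1 + L) * (t * norm z) < s" "t > 0"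
      using eventually_happens'[OF trivial_limit_at_right_real] by blast
    define y where "y = v + t *\<^sub>R z"
    have yv: "norm (y - v) = t * norm z" using t(3) by (simp add: y_def)
    have G: "norm (G y - G v) \<le> L * (t * norm z)"
      using lipschitz_onD[OF lip t(1) v] unfolding y_def[symmetric] dist_norm yv .
    have n: "norm ((y, G y) - (v, G v)) \<le> (1 + L) * (t * norm z)"
      using norm_Pair_le[of "y - v" "G y - G v"] yv G by (simp add: algebra_simps)
    have "(z, - d) \<bullet> ((y, G y) - (v, G v)) \<le> e * norm ((y, G y) - (v, G v))"
      using False t n by (intro s(2)) (auto simp: gph_def dist_norm y_def)
    also have "\<dots> \<le> e * ((1 + L) * (t * norm z))"
      using n \<open>e > 0\<close> by (intro mult_left_mono) auto
    finally have 1: "t * (norm z)\<^sup>2 - d \<bullet> (G y - G v) \<le> e * ((1 + L) * (t * norm z))"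
      by (simp add: y_def power2_norm_eq_inner)
    have "d \<bullet> (G y - G v) \<le> norm d * (L * (t * norm z))"
      using norm_cauchy_schwarz[of d "G y - G v"] mult_left_mono[OF G, of "norm d"] by simp
    with 1 have "(t * norm z) * norm z \<le> (t * norm z) * (L * norm d + e * (1 + L))"
      by (simp add: algebra_simps power2_eq_square)
    then show ?thesis using t(3) False by simp
  qed
  then have "norm z \<le> L * norm d + e" if "e > 0" for e
    using that[THEN divide_pos_pos, of "1 + L"] L
    by (metis add_pos_nonneg nonzero_eq_divide_eq less_irrefl zero_less_one)
  then show ?thesis by (rule field_le_epsilon)
qed

text \<open>The Lipschitz bound for regular normals at nearby graph points survives the limit. In
  particular direction 0 admits only z = 0.\<close>

lemma gen_hessian_bound:
  assumes C11: "C11 \<phi>"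
  obtains L where "\<And>d z. z \<in> gen_hessian \<phi> x d \<Longrightarrow> norm z \<le> L * norm d"
proof -
  obtain r L where r: "r > 0" and L: "L-lipschitz_on (ball x r) (grad \<phi>)"
    using C11 unfolding C11_def by blast
  have "norm z \<le> L * norm d" if z: "z \<in> gen_hessian \<phi> x d" for z d
  proof -
    obtain p w where p: "p \<longlonglongrightarrow> (x, grad \<phi> x)" and w: "w \<longlonglongrightarrow> (z, - d)"
      and pw: "\<And>k::nat. p k \<in> gph (grad \<phi>) \<and> w k \<in> regular_normal_cone (gph (grad \<phi>)) (p k)"
      using z unfolding gen_hessian_def limiting_normal_cone_def by blast
    have "(\<lambda>k. fst (p k)) \<longlonglongrightarrow> x" using tendsto_fst[OF p] by simp
    then have "\<forall>\<^sub>F k in sequentially. fst (p k) \<in> ball x r"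
      using r by (intro topological_tendstoD) auto
    then have ev: "\<forall>\<^sub>F k in sequentially. norm (fst (w k)) \<le> L * norm (snd (w k))"
    proof eventually_elim
      case (elim k)
      have "p k = (fst (p k), grad \<phi> (fst (p k)))" using pw[of k] by (auto simp: gph_def)
      then have "(fst (w k), - (- snd (w k))) \<in>
          regular_normal_cone (gph (grad \<phi>)) (fst (p k), grad \<phi> (fst (p k)))"
        using pw[of k] by simp
      from regular_normal_gph_bound[OF L elim this] show ?case by simp
    qed
    have "norm (fst (z, - d)) \<le> L * norm (snd (z, - d))"
      by (rule tendsto_le[OF sequentially_bot _ _ ev]) (intro tendsto_intros w)+
    then show ?thesis by simp
  qed
  then show ?thesis by (rule that)
qed

lemma gen_hessianI_scalar_subgradient:
  fixes v d z :: "nat \<Rightarrow> 'a::euclidean_space"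
  assumes "continuous_on UNIV (grad \<phi>)"
    and "v \<longlonglongrightarrow> x" "d \<longlonglongrightarrow> d'" "z \<longlonglongrightarrow> z'"
    and "\<And>k. scalar_subgradient (grad \<phi>) (v k) (d k) (z k)"
  shows "z' \<in> gen_hessian \<phi> x d'"
proof -
  have "(\<lambda>k. grad \<phi> (v k)) \<longlonglongrightarrow> grad \<phi> x"
    by (rule continuous_on_tendsto_compose[OF assms(1,2)]) simp_all
  then have "(\<lambda>k. (v k, grad \<phi> (v k))) \<longlonglongrightarrow> (x, grad \<phi> x)"
    using assms(2) by (intro tendsto_Pair)
  moreover have "(\<lambda>k. (z k, - d k)) \<longlonglongrightarrow> (z', - d')"
    using assms(3,4) by (intro tendsto_Pair tendsto_minus)
  moreover have "(v k, grad \<phi> (v k)) \<in> gph (grad \<phi>) \<and>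
      (z k, - d k) \<in> regular_normal_cone (gph (grad \<phi>)) (v k, grad \<phi> (v k))" for k
    using scalar_subgradient_imp_regular_normal[OF assms(5)] by (auto simp: gph_def)
  ultimately show ?thesis
    unfolding gen_hessian_def limiting_normal_cone_def by blast
qed

section \<open>Approximate mean value inequality and local injectivity\<close>

text \<open>Tilt f by a linear l with l \<bullet> (b - a) = m, so that the tilted h satisfies h b <
  h a. Minimise h plus n times the squared distance to the segment from a to b. For suitable large n
  the minimiser v lies inside the ball and its projection p differs from a. Then l - 2 n (v - p) is
  a proximal subgradient of f at v, and the projection inequality bounds its product with b - a by
  m.\<close>

lemma approximate_mean_value:
  fixes f :: "'a::euclidean_space \<Rightarrow> real"
  assumes f: "continuous_on UNIV f" and ab: "a \<in> ball c r" "b \<in> ball c r" "a \<noteq> b"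
    and m: "f b - f a < m"
  obtains v z C where "v \<in> ball c r" "z \<bullet> (b - a) \<le> m"
    "\<forall>\<^sub>F y in nhds v. z \<bullet> (y - v) - C * (norm (y - v))\<^sup>2 \<le> f y - f v"
proof -
  define S where "S = closed_segment a b"
  define \<pi> where "\<pi> = closest_point S"
  define d where "d = b - a"
  define l where "l = (m / (d \<bullet> d)) *\<^sub>R d"
  define h where "h v = f v - l \<bullet> (v - a)" for v
  have r0: "0 \<le> r" using ab(1) zero_le_dist[of c a] unfolding mem_ball by linarith
  have S: "closed S" "convex S" "S \<noteq> {}" "a \<in> S" "b \<in> S" by (auto simp: S_def)
  have Sc: "S \<subseteq> ball c r" unfolding S_def using ab by (intro closed_segment_subset) auto
  have \<pi>S: "\<pi> v \<in> S" for v unfolding \<pi>_def using S by (intro closest_point_in_set) auto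
  have contpi: "continuous_on UNIV \<pi>"
    unfolding \<pi>_def using S by (intro continuous_on_closest_point)
  have conth: "continuous_on UNIV h"
    unfolding h_def by (intro continuous_intros f)
  have dd: "d \<bullet> d > 0" using ab(3) by (simp add: d_def)
  have ld: "l \<bullet> d = m" using dd by (simp add: l_def)
  have hab: "h b < h a" using m ld by (simp add: h_def d_def)
  define H where "H n v = h v + real n * (norm (v - \<pi> v))\<^sup>2" for n v
  have "\<exists>v\<in>cball c r. \<forall>y\<in>cball c r. H n v \<le> H n y" for n
    unfolding H_def using ab(1) r0
    by (intro continuous_attains_inf continuous_intros continuous_on_subset[OF conth]
        continuous_on_subset[OF contpi]) auto
  then obtain V where V: "\<And>n. V n \<in> cball c r" "\<And>n y. y \<in> cball c r \<Longrightarrow> H n (V n) \<le> H n y"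
    by metis
  obtain w \<sigma> where w: "w \<in> cball c r" "strict_mono \<sigma>" "(V \<circ> \<sigma>) \<longlonglongrightarrow> w"
    using compact_cball[of c r] V(1) unfolding compact_def by metis
  have Vw: "(\<lambda>k. V (\<sigma> k)) \<longlonglongrightarrow> w" using w(3) by (simp add: o_def)
  have \<pi>w: "(\<lambda>k. \<pi> (V (\<sigma> k))) \<longlonglongrightarrow> \<pi> w"
    by (rule continuous_on_tendsto_compose[OF contpi Vw]) simp_all
  have hw: "(\<lambda>k. h (V (\<sigma> k))) \<longlonglongrightarrow> h w"
    by (rule continuous_on_tendsto_compose[OF conth Vw]) simp_all
  have \<pi>b: "\<pi> b = b" unfolding \<pi>_def using S by (intro closest_point_self)
  have Hb: "h (V n) + real n * (norm (V n - \<pi> (V n)))\<^sup>2 \<le> h b" for n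
    using V(2)[of b n] ab(2) \<pi>b by (simp add: H_def)
  have hV: "h (V n) \<le> h b" for n
    using Hb[of n] by (smt (verit) mult_nonneg_nonneg of_nat_0_le_iff zero_le_power2)
  \<comment> \<open>Comparison with b keeps the limit of the penalty minimisers away from a.\<close>
  have "h w \<le> h b"
    by (rule tendsto_upperbound[OF hw]) (auto simp: hV)
  then have wa: "w \<noteq> a" using hab by auto
  \<comment> \<open>A lower bound of h on the ball forces the squared distance to the segment to
    decay like 1/k.\<close>
  obtain u where u: "u \<in> cball c r" "\<And>y. y \<in> cball c r \<Longrightarrow> h u \<le> h y"
    using continuous_attains_inf[OF compact_cball _ continuous_on_subset[OF conth subset_UNIV], of c r]
      r0 by auto
  have "(norm (V (\<sigma> k) - \<pi> (V (\<sigma> k))))\<^sup>2 \<le> (h b - h u) / real k" if "k > 0" for k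
  proof -
    have "real k * (norm (V (\<sigma> k) - \<pi> (V (\<sigma> k))))\<^sup>2 \<le> real (\<sigma> k) * (norm (V (\<sigma> k) - \<pi> (V (\<sigma> k))))\<^sup>2"
      using seq_suble[OF w(2), of k] by (intro mult_right_mono) auto
    also have "\<dots> \<le> h b - h u" using Hb[of "\<sigma> k"] u(2)[OF V(1)[of "\<sigma> k"]] by linarith
    finally show ?thesis using that by (simp add: pos_le_divide_eq mult.commute)
  qed
  then have ev: "\<forall>\<^sub>F k in sequentially. (norm (V (\<sigma> k) - \<pi> (V (\<sigma> k))))\<^sup>2 \<le> (h b - h u) / real k"
    by (rule eventually_mono[OF eventually_gt_at_top[of 0]])
  have "(norm (w - \<pi> w))\<^sup>2 \<le> 0"
    by (rule tendsto_le[OF _ lim_const_over_n _ ev]) (auto intro!: tendsto_intros Vw \<pi>w)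
  then have "\<pi> w = w" by simp
  have "\<forall>\<^sub>F k in sequentially. V (\<sigma> k) \<in> ball c r"
    using \<open>\<pi> w = w\<close> \<pi>S[of w] Sc by (intro topological_tendstoD[OF Vw]) auto
  moreover have "\<forall>\<^sub>F k in sequentially. \<pi> (V (\<sigma> k)) \<in> - {a}"
    using \<open>\<pi> w = w\<close> wa by (intro topological_tendstoD[OF \<pi>w]) auto
  ultimately have "\<forall>\<^sub>F k in sequentially. V (\<sigma> k) \<in> ball c r \<and> \<pi> (V (\<sigma> k)) \<noteq> a"
    by eventually_elim simp
  then obtain k where k: "V (\<sigma> k) \<in> ball c r" "\<pi> (V (\<sigma> k)) \<noteq> a"
    using eventually_happens'[OF sequentially_bot] by blast
  define n where "n = \<sigma> k"
  define v where "v = V n"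
  define p where "p = \<pi> v"
  have v: "v \<in> ball c r" and pa: "p \<noteq> a" using k by (simp_all add: v_def n_def p_def)
  obtain t where t: "0 \<le> t" "p = a + t *\<^sub>R d"
    using \<pi>S[of v] unfolding S_def p_def[symmetric] in_segment d_def
    by (auto simp: algebra_simps)
  \<comment> \<open>The projection inequality is tested at the endpoint a, where a - p = -t d; since
    p \<noteq> a, the factor t can be cancelled.\<close>
  have "(v - p) \<bullet> (a - p) \<le> 0"
    unfolding p_def \<pi>_def using S by (intro closest_point_dot) auto
  then have "t * ((v - p) \<bullet> d) \<ge> 0" using t(2) by simp
  moreover have "t > 0" using t pa by (cases "t = 0") auto
  ultimately have vpd: "(v - p) \<bullet> d \<ge> 0" by (simp add: zero_le_mult_iff)
  define z where "z = l - (2 * real n) *\<^sub>R (v - p)"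
  have zd: "z \<bullet> (b - a) \<le> m"
    using ld vpd by (simp add: z_def inner_diff_left d_def[symmetric])
  have "z \<bullet> (y - v) - real n * (norm (y - v))\<^sup>2 \<le> f y - f v" if y: "y \<in> ball c r" for y
  proof -
    \<comment> \<open>Replacing the projection of y by the fixed p only enlarges the penalty, with
      equality at y = v, and leaves a smooth quadratic to expand at v.\<close>
    have "dist y (\<pi> y) \<le> dist y p"
      unfolding \<pi>_def using S \<pi>S[of v] by (intro closest_point_le) (auto simp: p_def)
    then have "real n * (norm (y - \<pi> y))\<^sup>2 \<le> real n * (norm (y - p))\<^sup>2"
      by (intro mult_left_mono power_mono) (auto simp: dist_norm)
    moreover have "H n v \<le> H n y" unfolding v_def using V(2) y by simp
    ultimately have "h v + real n * (norm (v - p))\<^sup>2 \<le> h y + real n * (norm (y - p))\<^sup>2"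
      by (simp add: H_def p_def)
    moreover have "(norm (y - p))\<^sup>2 = (norm (v - p))\<^sup>2 + 2 * ((v - p) \<bullet> (y - v)) + (norm (y - v))\<^sup>2"
      unfolding power2_norm_eq_inner
      by (simp add: inner_diff_left inner_diff_right inner_commute algebra_simps)
    ultimately show ?thesis
      by (simp add: h_def z_def inner_diff_left inner_diff_right algebra_simps)
  qed
  then have "\<forall>\<^sub>F y in nhds v. z \<bullet> (y - v) - real n * (norm (y - v))\<^sup>2 \<le> f y - f v"
    using v unfolding eventually_nhds by (metis open_ball)
  with v zd show ?thesis by (rule that)
qed

text \<open>If F a = F b, the mean value inequality for y \<mapsto> d \<bullet> F y with d = b - a
  yields a subgradient z with z \<bullet> d at most half of what coercivity demands.\<close>

lemma scalar_subgradient_coercive_inj_on: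
  fixes F :: "'a::euclidean_space \<Rightarrow> 'a"
  assumes F: "continuous_on UNIV F" and "\<delta> > 0"
    and co: "\<And>v d z. v \<in> ball x r \<Longrightarrow> scalar_subgradient F v d z \<Longrightarrow> \<delta> * (norm d)\<^sup>2 \<le> z \<bullet> d"
  shows "inj_on F (ball x r)"
proof (rule inj_onI, rule ccontr)
  fix a b assume ab: "a \<in> ball x r" "b \<in> ball x r" "F a = F b" "a \<noteq> b"
  define d where "d = b - a"
  have pos: "\<delta> * (norm d)\<^sup>2 > 0" using ab(4) \<open>\<delta> > 0\<close> by (simp add: d_def)
  have "continuous_on UNIV (\<lambda>v. d \<bullet> F v)" by (intro continuous_intros F)
  moreover have "d \<bullet> F b - d \<bullet> F a < \<delta> * (norm d)\<^sup>2 / 2" using pos ab(3) by simp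
  ultimately obtain v z C where v: "v \<in> ball x r" "z \<bullet> (b - a) \<le> \<delta> * (norm d)\<^sup>2 / 2"
    "\<forall>\<^sub>F y in nhds v. z \<bullet> (y - v) - C * (norm (y - v))\<^sup>2 \<le> d \<bullet> F y - d \<bullet> F v"
    using approximate_mean_value[OF _ ab(1,2,4)] by blast
  have "scalar_subgradient F v d z"
    by (rule scalar_subgradient_quadraticI[of _ _ C]) (use v(3) in \<open>simp add: inner_diff_right\<close>)
  from co[OF v(1) this] v(2) pos show False by (simp add: d_def)
qed

section \<open>Coercivity and solvability of the regularized Newton inclusion\<close>

text \<open>Otherwise there are violating subgradients at points tending to x. Normalised to unit d,
  they subconverge to some z0 in the generalized Hessian at x in a unit direction d' with z0
  \<bullet> d' + A d' \<bullet> d' \<le> 0, against semidefiniteness at x and definiteness of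
  A.\<close>

lemma psd_gen_hessian_coercive:
  fixes \<phi> :: "'a::euclidean_space \<Rightarrow> real"
  assumes C11: "C11 \<phi>" and psd: "psd_gen_hessian \<phi> x"
    and A: "linear A" "\<And>u w. A u \<bullet> w = u \<bullet> A w" "\<And>u. u \<noteq> 0 \<Longrightarrow> A u \<bullet> u > 0"
  obtains r \<delta> where "r > 0" "\<delta> > 0"
    "\<And>v d z. v \<in> ball x r \<Longrightarrow> scalar_subgradient (\<lambda>y. grad \<phi> y + A y) v d z \<Longrightarrow>
       \<delta> * (norm d)\<^sup>2 \<le> z \<bullet> d"
proof -
  let ?F = "\<lambda>y. grad \<phi> y + A y"
  define \<epsilon> where "\<epsilon> n = inverse (real (Suc n))" for n
  have \<epsilon>: "\<epsilon> n > 0" "\<epsilon> \<longlonglongrightarrow> 0" for n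
    unfolding \<epsilon>_def using LIMSEQ_inverse_real_of_nat by auto
  obtain s L where s: "s > 0" and L: "L-lipschitz_on (ball x s) (grad \<phi>)"
    using C11 unfolding C11_def by blast
  have cont: "continuous_on UNIV (grad \<phi>)" using C11 by (simp add: C11_def)
  \<comment> \<open>The same null sequence serves as radius and as coercivity constant, so a failure
    for every n produces the violating sequences.\<close>
  have "\<exists>n. \<forall>v d z. v \<in> ball x (\<epsilon> n) \<longrightarrow> scalar_subgradient ?F v d z \<longrightarrow>
      \<epsilon> n * (norm d)\<^sup>2 \<le> z \<bullet> d"
  proof (rule ccontr)
    assume "\<not> ?thesis"
    then have "\<forall>n. \<exists>v d z. v \<in> ball x (\<epsilon> n) \<and> scalar_subgradient ?F v d z \<and> z \<bullet> d < \<epsilon> n * (norm d)\<^sup>2"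
      by (meson not_le)
    then obtain v d z where v: "\<And>n. v n \<in> ball x (\<epsilon> n)"
      and sub: "\<And>n. scalar_subgradient ?F (v n) (d n) (z n)"
      and less: "\<And>n. z n \<bullet> d n < \<epsilon> n * (norm (d n))\<^sup>2"
      by metis
    have vx: "v \<longlonglongrightarrow> x"
    proof (rule metric_tendsto_imp_tendsto[OF \<epsilon>(2)])
      show "\<forall>\<^sub>F n in sequentially. dist (v n) x \<le> dist (\<epsilon> n) 0"
        using v \<epsilon>(1) by (intro always_eventually allI) (simp add: dist_commute less_imp_le)
    qed
    have "\<forall>\<^sub>F n in sequentially. v n \<in> ball x s"
      using s by (intro topological_tendstoD[OF vx]) auto
    then obtain N where N: "\<And>n. n \<ge> N \<Longrightarrow> v n \<in> ball x s"
      unfolding eventually_sequentially by blast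
    have sub': "scalar_subgradient (grad \<phi>) (v n) (d n) (z n - A (d n))" for n
      by (rule scalar_subgradient_add_selfadjoint[OF sub A(1,2)])
    define z' where "z' n = z n - A (d n)" for n
    have bnd: "norm (z' n) \<le> L * norm (d n)" if "n \<ge> N" for n
      unfolding z'_def
      using regular_normal_gph_bound[OF L N[OF that] scalar_subgradient_imp_regular_normal[OF sub']] .
    have dn: "d n \<noteq> 0" for n using less[of n] by auto
    \<comment> \<open>Subgradients scale with d, so d may be normalised; the Lipschitz bound then
      keeps the scaled z' bounded.\<close>
    define t where "t n = inverse (norm (d n))" for n
    have t: "t n > 0" for n using dn by (simp add: t_def)
    define D where "D n = t n *\<^sub>R d n" for n
    define Z where "Z n = t n *\<^sub>R z' n" for n
    have D1: "norm (D n) = 1" for n using dn by (simp add: D_def t_def)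
    have Zb: "norm (Z n) \<le> L" if "n \<ge> N" for n
      using bnd[OF that] dn[of n] by (simp add: Z_def t_def field_simps)
    have subDZ: "scalar_subgradient (grad \<phi>) (v n) (D n) (Z n)" for n
      unfolding D_def Z_def z'_def by (rule scalar_subgradient_scale[OF sub' t])
    have lessDZ: "Z n \<bullet> D n + A (D n) \<bullet> D n \<le> \<epsilon> n" for n
    proof -
      have "Z n \<bullet> D n + A (D n) \<bullet> D n = (t n)\<^sup>2 * (z n \<bullet> d n)"
        by (simp add: Z_def D_def z'_def linear_scale[OF A(1)] inner_diff_left power2_eq_square algebra_simps)
      also have "\<dots> \<le> (t n)\<^sup>2 * (\<epsilon> n * (norm (d n))\<^sup>2)"
        using less[of n] by (intro mult_left_mono) auto
      also have "\<dots> = \<epsilon> n" using dn[of n] by (simp add: t_def power_inverse field_simps)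
      finally show ?thesis .
    qed
    \<comment> \<open>The shift by N restricts to the indices where the Lipschitz bound
      applies.\<close>
    have "\<forall>n. (D (n + N), Z (n + N)) \<in> cball 0 1 \<times> cball 0 L" using D1 Zb by simp
    moreover have "compact (cball (0::'a) 1 \<times> cball (0::'a) L)" by (intro compact_Times) auto
    ultimately obtain q \<sigma> where q: "strict_mono \<sigma>" "((\<lambda>n. (D (n + N), Z (n + N))) \<circ> \<sigma>) \<longlonglongrightarrow> q"
      unfolding compact_def by meson
    define d' z0 where "d' = fst q" and "z0 = snd q"
    have Dq: "(\<lambda>n. D (\<sigma> n + N)) \<longlonglongrightarrow> d'" and Zq: "(\<lambda>n. Z (\<sigma> n + N)) \<longlonglongrightarrow> z0"
      using tendsto_fst[OF q(2)] tendsto_snd[OF q(2)] by (simp_all add: o_def d'_def z0_def)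
    have \<sigma>N: "filterlim (\<lambda>n. \<sigma> n + N) sequentially sequentially"
      using filterlim_subseq[OF q(1)] by (rule filterlim_at_top_mono) simp
    have "z0 \<in> gen_hessian \<phi> x d'"
      by (rule gen_hessianI_scalar_subgradient[OF cont filterlim_compose[OF vx \<sigma>N] Dq Zq subDZ])
    then have "z0 \<bullet> d' \<ge> 0" using psd by (simp add: psd_gen_hessian_def)
    moreover have "norm d' = 1"
      using LIMSEQ_unique[OF tendsto_norm[OF Dq]] D1 by simp
    then have "A d' \<bullet> d' > 0" using A(3)[of d'] by fastforce
    moreover have "z0 \<bullet> d' + A d' \<bullet> d' \<le> 0"
    proof (rule tendsto_le)
      show "(\<lambda>n. \<epsilon> (\<sigma> n + N)) \<longlonglongrightarrow> 0" by (rule filterlim_compose[OF \<epsilon>(2) \<sigma>N])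
      have "(\<lambda>n. A (D (\<sigma> n + N))) \<longlonglongrightarrow> A d'"
        using A(1) Dq by (simp add: bounded_linear.tendsto[of A] linear_conv_bounded_linear)
      then show "(\<lambda>n. Z (\<sigma> n + N) \<bullet> D (\<sigma> n + N) + A (D (\<sigma> n + N)) \<bullet> D (\<sigma> n + N))
          \<longlonglongrightarrow> z0 \<bullet> d' + A d' \<bullet> d'"
        by (intro tendsto_intros Zq Dq)
    qed (auto simp: lessDZ)
    ultimately show False by linarith
  qed
  then show ?thesis using \<epsilon>(1) that by blast
qed

text \<open>The direction is the limit of the multipliers \<open>n (F y\<^sub>n - F x)\<close>, where \<open>F = \<nabla>\<phi> + A\<close> and
  \<open>y\<^sub>n\<close> minimises the penalty function \<open>\<langle>g, y\<rangle> + (n/2) \<parallel>F y - F x\<parallel>\<^sup>2\<close> near \<open>x\<close>. Coercivity makes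
  \<open>x\<close> the only point nearby with value \<open>F x\<close>, so that \<open>y\<^sub>n\<close> tends to \<open>x\<close>, and it bounds the
  multipliers.\<close>

lemma regularized_newton_solvable:
  fixes \<phi> :: "'a::euclidean_space \<Rightarrow> real"
  assumes C11: "C11 \<phi>" and psd: "psd_gen_hessian \<phi> x"
    and A: "linear A" "\<And>u w. A u \<bullet> w = u \<bullet> A w" "\<And>u. u \<noteq> 0 \<Longrightarrow> A u \<bullet> u > 0"
  obtains d where "- g - A d \<in> gen_hessian \<phi> x d"
proof -
  define F where "F y = grad \<phi> y + A y" for y
  obtain r \<delta> where r: "r > 0" "\<delta> > 0"
    and co: "\<And>v d z. v \<in> ball x r \<Longrightarrow> scalar_subgradient F v d z \<Longrightarrow> \<delta> * (norm d)\<^sup>2 \<le> z \<bullet> d"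
    using psd_gen_hessian_coercive[OF C11 psd A] unfolding F_def[abs_def] by metis
  have cont: "continuous_on UNIV (grad \<phi>)" using C11 by (simp add: C11_def)
  have contA: "continuous_on UNIV A" using A(1) by (simp add: linear_continuous_on linear_conv_bounded_linear)
  have contF: "continuous_on UNIV F" unfolding F_def by (intro continuous_intros cont contA)
  have inj: "inj_on F (ball x r)"
    by (rule scalar_subgradient_coercive_inj_on[OF contF r(2) co])
  obtain s L where s: "s > 0" and L: "L-lipschitz_on (ball x s) (grad \<phi>)"
    using C11 unfolding C11_def by blast
  obtain M where M: "\<And>u. norm (A u) \<le> norm u * M"
    using A(1) unfolding linear_conv_bounded_linear by (metis bounded_linear.bounded)
  \<comment> \<open>Halving puts the closed ball inside both the coercivity ball and the Lipschitz
    ball.\<close>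
  define R where "R = min r s / 2"
  have R: "R > 0" "cball x R \<subseteq> ball x r" "cball x R \<subseteq> ball x s"
    using r(1) s by (auto simp: R_def)
  define K where "K = L + M"
  have lipF: "norm (F y - F y') \<le> K * norm (y - y')" if "y \<in> cball x R" "y' \<in> cball x R" for y y'
  proof -
    have "F y - F y' = (grad \<phi> y - grad \<phi> y') + A (y - y')"
      by (simp add: F_def linear_diff[OF A(1)])
    then have "norm (F y - F y') \<le> norm (grad \<phi> y - grad \<phi> y') + norm (A (y - y'))"
      by (metis norm_triangle_ineq)
    also have "\<dots> \<le> L * norm (y - y') + norm (y - y') * M"
      using lipschitz_onD[OF L subsetD[OF R(3) that(1)] subsetD[OF R(3) that(2)]] M
      by (intro add_mono) (auto simp: dist_norm)
    finally show ?thesis by (simp add: K_def algebra_simps)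
  qed
  define P where "P n y = g \<bullet> y + real n / 2 * (norm (F y - F x))\<^sup>2" for n y
  have "\<exists>v\<in>cball x R. \<forall>y\<in>cball x R. P n v \<le> P n y" for n
    unfolding P_def using R(1)
    by (intro continuous_attains_inf continuous_intros continuous_on_subset[OF contF]) auto
  then obtain V where V: "\<And>n. V n \<in> cball x R" "\<And>n y. y \<in> cball x R \<Longrightarrow> P n (V n) \<le> P n y"
    by metis
  define D where "D n = real n *\<^sub>R (F (V n) - F x)" for n
  \<comment> \<open>Expanding the penalty square about F (V n), the linear part has multiplier
    \<open>D n\<close> and the remainder is quadratic by the Lipschitz bound on F.\<close>
  have sub: "scalar_subgradient F (V n) (D n) (- g)" if n: "V n \<in> ball x R" for n
  proof (rule scalar_subgradient_quadraticI)
    have "- g \<bullet> (y - V n) - real n / 2 * K\<^sup>2 * (norm (y - V n))\<^sup>2 \<le> D n \<bullet> (F y - F (V n))"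
      if y: "y \<in> ball x R" for y
    proof -
      have "P n (V n) \<le> P n y" using V(2) y by simp
      moreover have "(norm (F y - F x))\<^sup>2 =
          (norm (F (V n) - F x))\<^sup>2 + 2 * ((F (V n) - F x) \<bullet> (F y - F (V n))) + (norm (F y - F (V n)))\<^sup>2"
        unfolding power2_norm_eq_inner
        by (simp add: inner_diff_left inner_diff_right inner_commute algebra_simps)
      moreover have "real n / 2 * (norm (F y - F (V n)))\<^sup>2 \<le> real n / 2 * (K * norm (y - V n))\<^sup>2"
        using lipF[of y "V n"] y V(1) by (intro mult_left_mono power_mono) auto
      ultimately show ?thesis
        by (simp add: P_def D_def inner_diff_right power_mult_distrib algebra_simps)
    qed
    then show "\<forall>\<^sub>F y in nhds (V n). - g \<bullet> (y - V n) - real n / 2 * K\<^sup>2 * (norm (y - V n))\<^sup>2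
        \<le> D n \<bullet> (F y - F (V n))"
      using n unfolding eventually_nhds by (metis open_ball)
  qed
  have Db: "norm (D n) \<le> norm g / \<delta>" if n: "V n \<in> ball x R" for n
  proof (cases "D n = 0")
    case False
    have "\<delta> * (norm (D n))\<^sup>2 \<le> - g \<bullet> D n"
      using co[OF subsetD[OF R(2) V(1)] sub[OF n]] .
    also have "\<dots> \<le> norm g * norm (D n)"
      using norm_cauchy_schwarz[of "- g" "D n"] by simp
    finally show ?thesis
      using False r(2) by (simp add: power2_eq_square pos_le_divide_eq mult.commute)
  qed (use r(2) in simp)
  obtain w \<sigma> where w: "w \<in> cball x R" "strict_mono \<sigma>" "(V \<circ> \<sigma>) \<longlonglongrightarrow> w"
    using compact_cball[of x R] V(1) unfolding compact_def by metis
  have Vw: "(\<lambda>k. V (\<sigma> k)) \<longlonglongrightarrow> w" using w(3) by (simp add: o_def)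
  have FVw: "(\<lambda>k. F (V (\<sigma> k))) \<longlonglongrightarrow> F w"
    by (rule continuous_on_tendsto_compose[OF contF Vw]) simp_all
  \<comment> \<open>Comparing the minimiser with x, where the penalty vanishes, bounds the penalty
    by the variation of g \<bullet> y over the ball.\<close>
  have "(norm (F (V (\<sigma> k)) - F x))\<^sup>2 \<le> (2 * norm g * R) / real k" if "k > 0" for k
  proof -
    have "real k * (norm (F (V (\<sigma> k)) - F x))\<^sup>2 \<le> real (\<sigma> k) * (norm (F (V (\<sigma> k)) - F x))\<^sup>2"
      using seq_suble[OF w(2), of k] by (intro mult_right_mono) auto
    also have "\<dots> \<le> 2 * (g \<bullet> (x - V (\<sigma> k)))"
      using V(2)[of x "\<sigma> k"] R(1) by (simp add: P_def inner_diff_right)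
    also have "\<dots> \<le> 2 * (norm g * norm (x - V (\<sigma> k)))"
      using norm_cauchy_schwarz[of g "x - V (\<sigma> k)"] by simp
    also have "\<dots> \<le> 2 * (norm g * R)"
      using V(1)[of "\<sigma> k"] by (intro mult_left_mono) (auto simp: dist_norm)
    finally show ?thesis using that by (simp add: pos_le_divide_eq mult.commute)
  qed
  then have ev: "\<forall>\<^sub>F k in sequentially. (norm (F (V (\<sigma> k)) - F x))\<^sup>2 \<le> (2 * norm g * R) / real k"
    by (rule eventually_mono[OF eventually_gt_at_top[of 0]])
  have "(norm (F w - F x))\<^sup>2 \<le> 0"
    by (rule tendsto_le[OF _ lim_const_over_n _ ev]) (auto intro!: tendsto_intros FVw)
  then have "F w = F x" by simp
  then have wx: "w = x" using inj_onD[OF inj] subsetD[OF R(2) w(1)] r(1) by simp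
  have "\<forall>\<^sub>F k in sequentially. V (\<sigma> k) \<in> ball x R"
    using R(1) wx by (intro topological_tendstoD[OF Vw]) auto
  then obtain N where N: "\<And>k. k \<ge> N \<Longrightarrow> V (\<sigma> k) \<in> ball x R"
    unfolding eventually_sequentially by blast
  have "\<forall>k. D (\<sigma> (k + N)) \<in> cball 0 (norm g / \<delta>)" using Db N by simp
  then obtain d \<kappa> where d: "strict_mono \<kappa>" "((\<lambda>k. D (\<sigma> (k + N))) \<circ> \<kappa>) \<longlonglongrightarrow> d"
    using compact_cball[of 0 "norm g / \<delta>"] unfolding compact_def by meson
  define \<iota> where "\<iota> k = \<sigma> (\<kappa> k + N)" for k
  have Dd: "(\<lambda>k. D (\<iota> k)) \<longlonglongrightarrow> d" using d(2) by (simp add: o_def \<iota>_def)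
  have "filterlim (\<lambda>k. \<kappa> k + N) sequentially sequentially"
    using filterlim_subseq[OF d(1)] by (rule filterlim_at_top_mono) simp
  from filterlim_compose[OF Vw this] have Vx: "(\<lambda>k. V (\<iota> k)) \<longlonglongrightarrow> x"
    by (simp add: \<iota>_def wx)
  have "(\<lambda>k. A (D (\<iota> k))) \<longlonglongrightarrow> A d"
    using A(1) Dd by (simp add: bounded_linear.tendsto[of A] linear_conv_bounded_linear)
  then have Zz: "(\<lambda>k. - g - A (D (\<iota> k))) \<longlonglongrightarrow> - g - A d" by (intro tendsto_intros)
  \<comment> \<open>The sum rule strips A off again, leaving subgradients for \<nabla>\<phi>
    alone.\<close>
  have "scalar_subgradient (grad \<phi>) (V (\<iota> k)) (D (\<iota> k)) (- g - A (D (\<iota> k)))" for k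
    using sub[of "\<iota> k"] N A(1,2) unfolding F_def[abs_def] \<iota>_def
    by (intro scalar_subgradient_add_selfadjoint) auto
  then have "- g - A d \<in> gen_hessian \<phi> x d"
    by (rule gen_hessianI_scalar_subgradient[OF cont Vx Dd Zz])
  then show ?thesis by (rule that)
qed

section \<open>Existence of Wolfe stepsizes\<close>

text \<open>A minimiser of \<open>t \<mapsto> \<phi> (x + t d) - \<sigma>2 t \<langle>\<nabla>\<phi> x, d\<rangle>\<close> over \<open>t \<ge> 0\<close> satisfies both conditions, the
  curvature condition with equality.\<close>

lemma wolfe_step_exists:
  assumes C11: "C11 \<phi>" and bdd: "bdd_below (range \<phi>)"
    and \<sigma>: "0 < \<sigma>1" "\<sigma>1 < \<sigma>2" "\<sigma>2 < 1" and desc: "grad \<phi> x \<bullet> d < 0"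
  shows "\<exists>\<tau>>0. wolfe \<phi> \<sigma>1 \<sigma>2 x d \<tau>"
proof -
  define s where "s = grad \<phi> x \<bullet> d"
  have s: "s < 0" using desc by (simp add: s_def)
  define q where "q t = \<phi> (x + t *\<^sub>R d) - \<sigma>2 * s * t" for t
  have der: "(q has_real_derivative (grad \<phi> (x + t *\<^sub>R d) \<bullet> d - \<sigma>2 * s)) (at t)" for t
  proof -
    have "((\<lambda>t. x + t *\<^sub>R d) has_derivative (\<lambda>h. h *\<^sub>R d)) (at t)"
      by (auto intro!: derivative_eq_intros)
    moreover have "(\<phi> has_derivative (\<lambda>h. h \<bullet> grad \<phi> (x + t *\<^sub>R d))) (at (x + t *\<^sub>R d))"
      using C11_GDERIV[OF C11] by (simp add: gderiv_def)
    ultimately have "((\<lambda>t. \<phi> (x + t *\<^sub>R d)) has_derivative (\<lambda>h. (h *\<^sub>R d) \<bullet> grad \<phi> (x + t *\<^sub>R d))) (at t)"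
      by (rule has_derivative_compose)
    then have "((\<lambda>t. \<phi> (x + t *\<^sub>R d)) has_real_derivative (grad \<phi> (x + t *\<^sub>R d) \<bullet> d)) (at t)"
      by (rule has_derivative_imp_has_field_derivative) (simp add: inner_commute)
    then show ?thesis unfolding q_def by (auto intro!: derivative_eq_intros)
  qed
  obtain m where m: "\<And>y. m \<le> \<phi> y" using bdd by (auto simp: bdd_below_def)
  have c: "- (\<sigma>2 * s) > 0" using s \<sigma> by (simp add: mult_pos_neg)
  \<comment> \<open>From T on, the increasing term -\<sigma>2 s t exceeds the largest possible drop
    \<phi> x - m; the summand 1 makes this strict and T positive.\<close>
  define T where "T = (\<phi> x - m) / (- (\<sigma>2 * s)) + 1"
  have T: "T \<ge> 1" using m[of x] c by (simp add: T_def divide_nonneg_neg)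
  have big: "q t > q 0" if "t \<ge> T" for t
  proof -
    have "- (\<sigma>2 * s) * T = (\<phi> x - m) - \<sigma>2 * s"
      using c unfolding T_def distrib_left by auto
    then have "\<phi> x - m < - (\<sigma>2 * s) * T" using c by linarith
    also have "\<dots> \<le> - (\<sigma>2 * s) * t" using c that by (intro mult_left_mono) auto
    finally show ?thesis using m[of "x + t *\<^sub>R d"] by (simp add: q_def)
  qed
  have "continuous_on {0..T} q"
    by (intro continuous_at_imp_continuous_on ballI DERIV_isCont[OF der])
  then obtain \<tau> where \<tau>: "\<tau> \<in> {0..T}" "\<And>t. t \<in> {0..T} \<Longrightarrow> q \<tau> \<le> q t"
    using continuous_attains_inf[of "{0..T}" q] T by auto
  \<comment> \<open>The slope of q at 0 is (1 - \<sigma>2) s < 0, so 0 is not a minimiser; with the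
    growth beyond T the minimum is interior.\<close>
  have "grad \<phi> (x + 0 *\<^sub>R d) \<bullet> d - \<sigma>2 * s < 0"
    using s \<sigma> mult_strict_right_mono_neg[of \<sigma>2 1 s] by (simp add: s_def)
  from DERIV_neg_dec_right[OF der this] obtain e where e: "e > 0" "\<And>h. 0 < h \<Longrightarrow> h < e \<Longrightarrow> q h < q 0"
    by auto
  define h where "h = min (e / 2) T"
  have h: "0 < h" "h < e" "h \<in> {0..T}" using e(1) T by (auto simp: h_def)
  have q0: "q \<tau> < q 0" using \<tau>(2)[OF h(3)] e(2)[OF h(1,2)] by linarith
  then have pos: "0 < \<tau>" and "\<tau> < T"
    using \<tau>(1) big[of \<tau>] by (auto simp: less_le)
  then have "grad \<phi> (x + \<tau> *\<^sub>R d) \<bullet> d - \<sigma>2 * s = 0"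
    using \<tau>(2) by (intro DERIV_local_min[OF der, of "min \<tau> (T - \<tau>)"]) (auto simp: abs_less_iff)
  moreover have "\<phi> (x + \<tau> *\<^sub>R d) \<le> \<phi> x + \<sigma>1 * \<tau> * s"
  proof -
    \<comment> \<open>q \<tau> < q 0 is sufficient decrease with constant \<sigma>2, which is
      stronger than with \<sigma>1 because s < 0.\<close>
    have "\<sigma>2 * (\<tau> * s) \<le> \<sigma>1 * (\<tau> * s)"
      using \<sigma> s pos by (intro mult_right_mono_neg) (auto simp: mult_nonneg_nonpos)
    then show ?thesis using q0 by (simp add: q_def algebra_simps)
  qed
  ultimately have "wolfe \<phi> \<sigma>1 \<sigma>2 x d \<tau>" by (simp add: wolfe_def s_def)
  then show ?thesis using pos by blast
qed

section \<open>Newton directions and runs of the algorithm\<close>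

lemma newton_direction_exists:
  assumes C11: "C11 \<phi>" and psd: "psd_gen_hessian \<phi> x" and "c > 0" and g: "grad \<phi> x \<noteq> 0"
    and B: "sym_posdef B"
  shows "\<exists>d. newton_direction \<phi> c \<rho> x B d"
proof -
  define \<mu> where "\<mu> = reg_param \<phi> c \<rho> x"
  have \<mu>: "\<mu> > 0" using \<open>c > 0\<close> g by (simp add: \<mu>_def reg_param_def)
  define A where "A d = \<mu> *\<^sub>R (B *v d)" for d
  have "linear A"
    unfolding A_def by (intro linear_compose_scale_right matrix_vector_mul_linear)
  moreover have "A u \<bullet> w = u \<bullet> A w" for u w
    using B dot_lmul_matrix[of u B w] unfolding sym_posdef_def A_def
    by (metis inner_scaleR_left inner_scaleR_right transpose_matrix_vector)
  moreover have "A u \<bullet> u > 0" if "u \<noteq> 0" for u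
    using B \<mu> that by (simp add: sym_posdef_def A_def inner_commute)
  ultimately obtain d where "- grad \<phi> x - A d \<in> gen_hessian \<phi> x d"
    using regularized_newton_solvable[OF C11 psd] by metis
  moreover have "- grad \<phi> x = (- grad \<phi> x - A d) + A d" by simp
  ultimately show ?thesis
    unfolding newton_direction_def A_def \<mu>_def by blast
qed

lemma newton_direction_descent:
  assumes C11: "C11 \<phi>" and psd: "psd_gen_hessian \<phi> x" and "c > 0" and g: "grad \<phi> x \<noteq> 0"
    and B: "sym_posdef B" and d: "newton_direction \<phi> c \<rho> x B d"
  shows "d \<noteq> 0" and "grad \<phi> x \<bullet> d < 0"
proof -
  define \<mu> where "\<mu> = reg_param \<phi> c \<rho> x"
  have \<mu>: "\<mu> > 0" using \<open>c > 0\<close> g by (simp add: \<mu>_def reg_param_def)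
  obtain z where z: "z \<in> gen_hessian \<phi> x d" "- grad \<phi> x = z + \<mu> *\<^sub>R (B *v d)"
    using d unfolding newton_direction_def \<mu>_def by blast
  \<comment> \<open>For d = 0 this bound gives z = 0, and the inclusion would then make the gradient
    vanish.\<close>
  obtain L where "norm z \<le> L * norm d" using gen_hessian_bound[OF C11] z(1) by metis
  then show d0: "d \<noteq> 0" using z(2) g by auto
  have "z \<bullet> d \<ge> 0" using psd z(1) by (simp add: psd_gen_hessian_def)
  moreover have "\<mu> * (d \<bullet> (B *v d)) > 0" using B \<mu> d0 by (simp add: sym_posdef_def)
  moreover have "- (grad \<phi> x \<bullet> d) = z \<bullet> d + \<mu> * (d \<bullet> (B *v d))"
    using arg_cong[OF z(2), of "\<lambda>u. u \<bullet> d"] by (simp add: inner_add_right inner_commute)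
  ultimately show "grad \<phi> x \<bullet> d < 0" by linarith
qed

lemma grnmw_step_decrease:
  assumes "C11 \<phi>" and "psd_gen_hessian \<phi> x" and "c > 0" and "0 < \<sigma>1"
    and step: "grnmw_step \<phi> c \<rho> \<sigma>1 \<sigma>2 \<tau>max x B d \<tau> x'"
  shows "\<phi> x' < \<phi> x"
proof -
  have desc: "grad \<phi> x \<bullet> d < 0"
    using newton_direction_descent(2) assms unfolding grnmw_step_def by blast
  have \<tau>: "\<tau> > 0" "wolfe \<phi> \<sigma>1 \<sigma>2 x d \<tau>" "x' = x + \<tau> *\<^sub>R d"
    using step unfolding grnmw_step_def by (auto split: if_splits)
  have "\<sigma>1 * \<tau> * (grad \<phi> x \<bullet> d) < 0"
    using \<tau>(1) desc \<open>0 < \<sigma>1\<close> by (intro mult_pos_neg) auto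
  then show ?thesis using \<tau>(2,3) by (simp add: wolfe_def)
qed

text \<open>Induction is needed because decrease at step k uses semidefiniteness at x k, which is
  assumed only in the sublevel set.\<close>

lemma grnmw_run_sublevel:
  assumes "C11 \<phi>" and psd: "\<forall>x. \<phi> x \<le> \<phi> x0 \<longrightarrow> psd_gen_hessian \<phi> x" and "c > 0" and "0 < \<sigma>1"
    and run: "grnmw_run \<phi> c \<rho> \<sigma>1 \<sigma>2 \<tau>max x0 N x B d \<tau>" and "enat k \<le> N"
  shows "\<phi> (x k) \<le> \<phi> x0"
  using \<open>enat k \<le> N\<close>
proof (induction k)
  case 0
  then show ?case using run by (simp add: grnmw_run_def)
next
  case (Suc k)
  then have k: "enat k < N" by (simp add: Suc_ile_eq)
  then have le: "\<phi> (x k) \<le> \<phi> x0" using Suc.IH by simp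
  have "grnmw_step \<phi> c \<rho> \<sigma>1 \<sigma>2 \<tau>max (x k) (B k) (d k) (\<tau> k) (x (Suc k))"
    using run k by (simp add: grnmw_run_def)
  then have "\<phi> (x (Suc k)) < \<phi> (x k)"
    using grnmw_step_decrease assms le by blast
  with le show ?case by simp
qed

theorem theorem4:
  fixes \<phi> :: "real^'n \<Rightarrow> real" and x0 :: "real^'n" and c \<rho> \<sigma>1 \<sigma>2 \<tau>max :: real
  assumes "C11 \<phi>"
    and "bdd_below (range \<phi>)"
    and "\<forall>x. \<phi> x \<le> \<phi> x0 \<longrightarrow> psd_gen_hessian \<phi> x"
    and "c > 0" and "0 < \<sigma>1" and "\<sigma>1 < \<sigma>2" and "\<sigma>2 < 1" and "0 < \<rho>" and "\<rho> \<le> 1"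
  shows "(\<forall>k x B d \<tau>.
            grnmw_run \<phi> c \<rho> \<sigma>1 \<sigma>2 \<tau>max x0 (enat k) x B d \<tau> \<and> grad \<phi> (x k) \<noteq> 0 \<longrightarrow>
            (\<forall>Bk. sym_posdef Bk \<longrightarrow>
               (\<exists>dk. dk \<noteq> 0 \<and> newton_direction \<phi> c \<rho> (x k) Bk dk) \<and>
               (\<forall>dk. newton_direction \<phi> c \<rho> (x k) Bk dk \<longrightarrow>
                  (\<exists>\<tau>k. \<tau>k > 0 \<and> wolfe \<phi> \<sigma>1 \<sigma>2 (x k) dk \<tau>k))))
       \<and> (\<forall>N x B d \<tau>.
            grnmw_execution \<phi> c \<rho> \<sigma>1 \<sigma>2 \<tau>max x0 N x B d \<tau> \<longrightarrow>
            (\<exists>K. N = enat K \<and> grad \<phi> (x K) = 0) \<or>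
            (N = \<infinity> \<and> (\<forall>k. \<phi> (x (Suc k)) < \<phi> (x k))))"
proof -
  have psd: "psd_gen_hessian \<phi> (x k)"
    if "grnmw_run \<phi> c \<rho> \<sigma>1 \<sigma>2 \<tau>max x0 N x B d \<tau>" "enat k \<le> N" for N x B d \<tau> k
    using grnmw_run_sublevel[OF assms(1,3,4,5) that] assms(3) by blast
  have solvable: "(\<exists>d. d \<noteq> 0 \<and> newton_direction \<phi> c \<rho> y Bk d) \<and>
      (\<forall>d. newton_direction \<phi> c \<rho> y Bk d \<longrightarrow> (\<exists>\<tau>. \<tau> > 0 \<and> wolfe \<phi> \<sigma>1 \<sigma>2 y d \<tau>))"
    if "psd_gen_hessian \<phi> y" "grad \<phi> y \<noteq> 0" "sym_posdef Bk" for y Bk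
    using newton_direction_exists[OF assms(1) that(1) assms(4) that(2,3), of \<rho>]
      newton_direction_descent[OF assms(1) that(1) assms(4) that(2,3), of \<rho>]
      wolfe_step_exists[OF assms(1,2,5,6,7), of y] by blast
  have alternative: "(\<exists>K. N = enat K \<and> grad \<phi> (x K) = 0) \<or> (N = \<infinity> \<and> (\<forall>k. \<phi> (x (Suc k)) < \<phi> (x k)))"
    if ex: "grnmw_execution \<phi> c \<rho> \<sigma>1 \<sigma>2 \<tau>max x0 N x B d \<tau>" for N x B d \<tau>
  proof (cases N)
    case (enat K)
    have run: "grnmw_run \<phi> c \<rho> \<sigma>1 \<sigma>2 \<tau>max x0 N x B d \<tau>"
      using ex by (simp add: grnmw_execution_def)
    have "\<not> grnmw_breakdown \<phi> c \<rho> \<sigma>1 \<sigma>2 (x K)"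
      using solvable[OF psd[OF run]] enat unfolding grnmw_breakdown_def by blast
    then show ?thesis using ex enat unfolding grnmw_execution_def by blast
  next
    case infinity
    have run: "grnmw_run \<phi> c \<rho> \<sigma>1 \<sigma>2 \<tau>max x0 N x B d \<tau>"
      using ex by (simp add: grnmw_execution_def)
    have "\<phi> (x (Suc k)) < \<phi> (x k)" for k
    proof (rule grnmw_step_decrease[OF assms(1) _ assms(4,5)])
      show "psd_gen_hessian \<phi> (x k)" using psd[OF run] infinity by simp
      show "grnmw_step \<phi> c \<rho> \<sigma>1 \<sigma>2 \<tau>max (x k) (B k) (d k) (\<tau> k) (x (Suc k))"
        using run infinity by (simp add: grnmw_run_def)
    qed
    then show ?thesis using infinity by blast
  qed
  show ?thesis
  proof (rule conjI; intro allI impI)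
    fix k x B d \<tau> and Bk :: "real^'n^'n"
    assume "grnmw_run \<phi> c \<rho> \<sigma>1 \<sigma>2 \<tau>max x0 (enat k) x B d \<tau> \<and> grad \<phi> (x k) \<noteq> 0" and B: "sym_posdef Bk"
    then have run: "grnmw_run \<phi> c \<rho> \<sigma>1 \<sigma>2 \<tau>max x0 (enat k) x B d \<tau>" and g: "grad \<phi> (x k) \<noteq> 0"
      by auto
    show "(\<exists>dk. dk \<noteq> 0 \<and> newton_direction \<phi> c \<rho> (x k) Bk dk) \<and>
        (\<forall>dk. newton_direction \<phi> c \<rho> (x k) Bk dk \<longrightarrow> (\<exists>\<tau>k. \<tau>k > 0 \<and> wolfe \<phi> \<sigma>1 \<sigma>2 (x k) dk \<tau>k))"
      by (rule solvable[OF psd[OF run order_refl] g B])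
  qed (rule alternative)
qed

end
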